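(* Let $G \in ER(n,d,\lambda)$, and let $x > 0$ and $m > 1$ be integers. Then the $(m,x)$-shadow $D_m^x(G)$ is edge-regular if and only if there exist nonnegative integers $d_x, \lambda_x$ such that the following three conditions hold: (1) for all $v \in V(G)$, $|N^x(v)| = d_x$; (2) for all $u,v \in V(G)$ with $u \sim v$ in $G$, $|N^x(u) \cap N^x(v)| = \lambda_x$; (3) for all $v,w \in V(G)$ with $w \in N^x(v)$, $|N^x(v) \cap N(w)| + |N(v) \cap N^x(w)| + (m-2)|N^x(v) \cap N^x(w)| = \lambda + (m-1)\lambda_x$.
   Context: All graphs are finite and simple. For a vertex $v$ of a graph $G$, $N(v)=N_G(v)$ is its neighborhood, and for a positive integer $x$, $N^x(v)=N^x_G(v)$ is the $x$-distance neighborhood of $v$ in $G$, i.e. the set of vertices at distance exactly $x$ from $v$ in $G$. A graph $G$ is edge-regular if it is regular and there is $\lambda \ge 0$ such that every two adjacent vertices have exactly $\lambda$ common neighbors; $ER(n,d,\lambda)$ denotes the set of edge-regular graphs on $n$ vertices, regular of degree $d$, with this parameter $\lambda$. For $x \ge 1$ and $m \ge 2$, the $(m,x)$-shadow $D_m^x(G)$ is the simple graph whose vertex set is the disjoint union of $m$ copies $G_1,\dots,G_m$ of $G$ (the copy of $u\in V(G)$ in $G_i$ denoted $u_i$), with edges $u_iv_i$ for $1\le i\le m$ and $uv \in E(G)$, and edges $u_iv_j$ for $1 \le i < j \le m$ whenever $u \in N_G^x(v)$. *)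

theory Defs
  imports "Graph_Theory.Pair_Digraph" "Graph_Theory.Shortest_Path"
begin

text \<open>
  A finite simple graph is a \<^term>\<open>pair_graph\<close>: a finite, loopless digraph without parallel arcs
  whose arc relation is symmetric. An edge \<open>uv\<close> is thus represented by the two arcs
  \<open>(u, v)\<close> and \<open>(v, u)\<close>. The null graph is allowed.
\<close>

definition nbhd :: "'a pair_pre_digraph \<Rightarrow> 'a \<Rightarrow> 'a set" where
  "nbhd G v = {u \<in> pverts G. (v, u) \<in> parcs G}"

text \<open>
  With unit weights, the library's shortest-path cost is the graph distance, with value
  \<open>\<infinity>\<close> between different components.
\<close>

definition graph_dist :: "'a pair_pre_digraph \<Rightarrow> 'a \<Rightarrow> 'a \<Rightarrow> ereal" where
  "graph_dist G u v = wf_digraph.\<mu> (with_proj G) (\<lambda>_. 1) u v"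

definition dist_nbhd :: "'a pair_pre_digraph \<Rightarrow> nat \<Rightarrow> 'a \<Rightarrow> 'a set" where
  "dist_nbhd G x v = {u \<in> pverts G. graph_dist G v u = ereal (real x)}"

text \<open>
  If \<open>G\<close> has no edges, the last condition is vacuous, and so \<open>G \<in> ER n 0 l\<close> for every \<open>l\<close>.
\<close>

definition ER :: "nat \<Rightarrow> nat \<Rightarrow> nat \<Rightarrow> 'a pair_pre_digraph set" where
  "ER n d l = {G. pair_graph G \<and> card (pverts G) = n \<and>
     (\<forall>v\<in>pverts G. card (nbhd G v) = d) \<and>
     (\<forall>u v. (u, v) \<in> parcs G \<longrightarrow> card (nbhd G u \<inter> nbhd G v) = l)}"

definition edge_regular :: "'a pair_pre_digraph \<Rightarrow> bool" where
  "edge_regular G \<longleftrightarrow> (\<exists>n d l. G \<in> ER n d l)"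

text \<open>
  The copy \<open>u\<^sub>i\<close> of a vertex \<open>u\<close> is the pair \<open>(u, i)\<close>. The arcs between different copies are
  listed for \<open>i < j\<close> only, and the converse supplies the opposite arcs.
\<close>

definition cross_arcs :: "nat \<Rightarrow> nat \<Rightarrow> 'a pair_pre_digraph \<Rightarrow> ('a \<times> nat) rel" where
  "cross_arcs m x G = {((u, i), (v, j)) | u v i j.
     1 \<le> i \<and> i < j \<and> j \<le> m \<and> v \<in> pverts G \<and> u \<in> dist_nbhd G x v}"

definition shadow :: "nat \<Rightarrow> nat \<Rightarrow> 'a pair_pre_digraph \<Rightarrow> ('a \<times> nat) pair_pre_digraph" where
  "shadow m x G =
     \<lparr> pverts = pverts G \<times> {1..m},
       parcs = {((u, i), (v, i)) | u v i. 1 \<le> i \<and> i \<le> m \<and> (u, v) \<in> parcs G}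
         \<union> cross_arcs m x G \<union> (cross_arcs m x G)\<inverse> \<rparr>"

end

theory Submission
  imports Defs
begin

text \<open>
  In the shadow, the neighborhood of \<open>v\<^sub>i\<close> consists of \<open>N(v)\<close> in the copy \<open>i\<close> and of \<open>N\<^sup>x(v)\<close> in
  each of the other \<open>m - 1\<close> copies. Counting copy by copy shows that \<open>v\<^sub>i\<close> has degree
  \<open>d + (m - 1) |N\<^sup>x(v)|\<close>, that adjacent vertices \<open>u\<^sub>i\<close>, \<open>v\<^sub>i\<close> of one copy have
  \<open>\<lambda> + (m - 1) |N\<^sup>x(u) \<inter> N\<^sup>x(v)|\<close> common neighbors, and that adjacent vertices of different copies have
  as many common neighbors as the left-hand side of condition (3) says. Edge-regularity of the shadow
  thus means that these three quantities are constant, the last two with the same value. An edge of \<open>G\<close>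
  forces this value to be \<open>\<lambda> + (m - 1) \<lambda>\<^sub>x\<close>; without edges every \<open>N\<^sup>x(v)\<close> is empty, and
  (2) and (3) are vacuous.
\<close>

context pair_graph
begin

lemma nbhd_subset: "nbhd G v \<subseteq> pverts G"
  by (auto simp: nbhd_def)

lemma dist_nbhd_subset: "dist_nbhd G x v \<subseteq> pverts G"
  by (auto simp: dist_nbhd_def)

lemma finite_nbhd [simp]: "finite (nbhd G v)"
  by (rule finite_subset[OF nbhd_subset pair_finite_verts])

lemma finite_dist_nbhd [simp]: "finite (dist_nbhd G x v)"
  by (rule finite_subset[OF dist_nbhd_subset pair_finite_verts])

lemma parcs_sym: "(u, v) \<in> parcs G \<longleftrightarrow> (v, u) \<in> parcs G"
  using arcs_symmetric by blast

lemma in_nbhd_iff: "u \<in> nbhd G v \<longleftrightarrow> (v, u) \<in> parcs G"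
  by (auto simp: nbhd_def dest: in_arcsD2)

text \<open>Reversal replaces each arc by its opposite, so the cost survives because the weight is
  constant.\<close>

lemma awalk_cost_rev_path: "awalk_cost (\<lambda>_. c) (rev_path p) = awalk_cost (\<lambda>_. c) p"
  by (induct p) auto

text \<open>Each walk from \<open>u\<close> to \<open>v\<close> reverses to a walk from
  \<open>v\<close> to \<open>u\<close> of equal cost, which bounds the infimum. Exchanging
  \<open>u\<close> and \<open>v\<close> gives the other inequality.\<close>

lemma graph_dist_le: "graph_dist G v u \<le> graph_dist G u v"
  unfolding graph_dist_def \<mu>_def
  by (rule INF_mono) (metis awalk_cost_rev_path awalk_rev_path mem_Collect_eq order_refl)

lemma graph_dist_commute: "graph_dist G u v = graph_dist G v u"
  by (intro antisym graph_dist_le)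

lemma dist_nbhd_commute:
  assumes "u \<in> pverts G" "v \<in> pverts G"
  shows "u \<in> dist_nbhd G x v \<longleftrightarrow> v \<in> dist_nbhd G x u"
  using assms by (simp add: dist_nbhd_def graph_dist_commute)

text \<open>Only empty walks exist here, so every distance is 0 or, as an infimum over the empty
  set, infinite.\<close>

lemma dist_nbhd_empty_if_no_arcs:
  assumes "parcs G = {}" and "x > 0"
  shows "dist_nbhd G x v = {}"
proof -
  have "graph_dist G v u \<noteq> ereal (real x)" for u
  proof (cases "{p. awalk v p u} = {}")
    case True
    then show ?thesis by (simp add: graph_dist_def \<mu>_def top_ereal_def)
  next
    case False
    moreover have "p = []" if "awalk v p u" for p
      using that assms(1) by (auto simp: awalk_def)
    ultimately have "{p. awalk v p u} = {[]}" by auto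
    then show ?thesis using assms(2) by (simp add: graph_dist_def \<mu>_def)
  qed
  then show ?thesis by (auto simp: dist_nbhd_def)
qed

text \<open>Symmetry of the distance merges the cases \<open>i < j\<close> and \<open>j < i\<close>,
  which the definition treats through a converse.\<close>

lemma parcs_shadow_iff:
  "((u, i), (v, j)) \<in> parcs (shadow m x G) \<longleftrightarrow>
     u \<in> pverts G \<and> i \<in> {1..m} \<and> j \<in> {1..m} \<and>
     (if i = j then v \<in> nbhd G u else v \<in> dist_nbhd G x u)"
  using dist_nbhd_commute[of u v x]
  by (cases i j rule: linorder_cases)
     (auto simp: shadow_def cross_arcs_def in_nbhd_iff
       dest: in_arcsD1 dist_nbhd_subset[THEN subsetD])

lemma pverts_shadow [simp]: "pverts (shadow m x G) = pverts G \<times> {1..m}"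
  by (simp add: shadow_def)

lemma nbhd_shadow:
  assumes "v \<in> pverts G" and "i \<in> {1..m}"
  shows "nbhd (shadow m x G) (v, i) = nbhd G v \<times> {i} \<union> dist_nbhd G x v \<times> ({1..m} - {i})"
  using assms
  by (auto simp: nbhd_def[of "shadow m x G"] parcs_shadow_iff split: if_splits
      dest: nbhd_subset[THEN subsetD] dist_nbhd_subset[THEN subsetD])

lemma pair_graph_shadow: "pair_graph (shadow m x G)"
proof -
  have verts: "u \<in> pverts G \<and> v \<in> pverts G \<and> i \<in> {1..m} \<and> j \<in> {1..m}"
    if "((u, i), (v, j)) \<in> parcs (shadow m x G)" for u i v j
    using that
    by (auto simp: parcs_shadow_iff split: if_splits
        dest: nbhd_subset[THEN subsetD] dist_nbhd_subset[THEN subsetD])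
  then have wf: "parcs (shadow m x G) \<subseteq> (pverts G \<times> {1..m}) \<times> (pverts G \<times> {1..m})"
    by fast
  show ?thesis
  proof
    show "finite (pverts (shadow m x G))"
      using pair_finite_verts by simp
    show "finite (parcs (shadow m x G))"
      by (rule finite_subset[OF wf]) (use pair_finite_verts in simp)
    show "symmetric (with_proj (shadow m x G))"
      unfolding symmetric_def with_proj_simps
    proof (rule symI, clarify)
      fix u i v j assume "((u, i), (v, j)) \<in> parcs (shadow m x G)"
      with verts[OF this] show "((v, j), (u, i)) \<in> parcs (shadow m x G)"
        by (auto simp: parcs_shadow_iff in_nbhd_iff parcs_sym[of v] dist_nbhd_commute[of u v]
            split: if_splits)
    qed
    \<comment> \<open>A loop would stay inside one copy and hence come from a loop of
      \<open>G\<close>.\<close>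
    show "fst e \<noteq> snd e" if "e \<in> parcs (shadow m x G)" for e
      using that by (cases e) (auto simp: parcs_shadow_iff in_nbhd_iff dest: no_loops')
  qed (use wf in force)+
qed

lemma card_copies:
  fixes A B :: "'a set"
  assumes "finite A" "finite B" "i \<in> {1..m::nat}"
  shows "card (A \<times> {i} \<union> B \<times> ({1..m} - {i})) = card A + (m - 1) * card B"
  using assms by (subst card_Un_disjoint) (auto simp: card_cartesian_product)

lemma card_nbhd_shadow:
  assumes "v \<in> pverts G" "i \<in> {1..m}"
  shows "card (nbhd (shadow m x G) (v, i)) = card (nbhd G v) + (m - 1) * card (dist_nbhd G x v)"
  unfolding nbhd_shadow[OF assms] by (intro card_copies finite_nbhd finite_dist_nbhd assms)

lemma card_common_nbhd_shadow_same_copy: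
  assumes "u \<in> pverts G" "v \<in> pverts G" "i \<in> {1..m}"
  shows "card (nbhd (shadow m x G) (u, i) \<inter> nbhd (shadow m x G) (v, i)) =
    card (nbhd G u \<inter> nbhd G v) + (m - 1) * card (dist_nbhd G x u \<inter> dist_nbhd G x v)"
proof -
  have "nbhd (shadow m x G) (u, i) \<inter> nbhd (shadow m x G) (v, i) =
    (nbhd G u \<inter> nbhd G v) \<times> {i} \<union> (dist_nbhd G x u \<inter> dist_nbhd G x v) \<times> ({1..m} - {i})"
    unfolding nbhd_shadow[OF assms(1,3)] nbhd_shadow[OF assms(2,3)] by auto
  then show ?thesis
    using card_copies[OF _ _ assms(3)] by simp
qed

text \<open>Copy \<open>i\<close> contributes N(u) \<inter> N^x(v), copy \<open>j\<close>
  contributes N^x(u) \<inter> N(v), and each of the remaining \<open>m - 2\<close> copies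
  contributes N^x(u) \<inter> N^x(v).\<close>

lemma card_common_nbhd_shadow_other_copy:
  assumes "u \<in> pverts G" "v \<in> pverts G" "i \<in> {1..m}" "j \<in> {1..m}" "i \<noteq> j"
  shows "card (nbhd (shadow m x G) (u, i) \<inter> nbhd (shadow m x G) (v, j)) =
    card (dist_nbhd G x u \<inter> nbhd G v) + card (nbhd G u \<inter> dist_nbhd G x v)
      + (m - 2) * card (dist_nbhd G x u \<inter> dist_nbhd G x v)"
proof -
  let ?A = "nbhd G u \<inter> dist_nbhd G x v" and ?B = "dist_nbhd G x u \<inter> nbhd G v"
    and ?C = "dist_nbhd G x u \<inter> dist_nbhd G x v"
  have "nbhd (shadow m x G) (u, i) \<inter> nbhd (shadow m x G) (v, j) =
    ?B \<times> {j} \<union> (?A \<times> {i} \<union> ?C \<times> ({1..m} - {i, j}))"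
    unfolding nbhd_shadow[OF assms(1,3)] nbhd_shadow[OF assms(2,4)] using assms by auto
  also have "card \<dots> = card (?B \<times> {j}) + card (?A \<times> {i} \<union> ?C \<times> ({1..m} - {i, j}))"
    using assms by (intro card_Un_disjoint) auto
  also have "card (?A \<times> {i} \<union> ?C \<times> ({1..m} - {i, j})) =
    card (?A \<times> {i}) + card (?C \<times> ({1..m} - {i, j}))"
    by (intro card_Un_disjoint) auto
  also have "card ({1..m} - {i, j}) = m - 2"
    using assms by (subst card_Diff_subset) auto
  then have "card (?C \<times> ({1..m} - {i, j})) = (m - 2) * card ?C"
    by (simp add: card_cartesian_product)
  finally show ?thesis by (simp add: card_cartesian_product)
qed

lemma shadow_in_ER_iff:
  assumes "m > 1"
  shows "shadow m x G \<in> ER N D L \<longleftrightarrow>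
    card (pverts G) * m = N \<and>
    (\<forall>v\<in>pverts G. card (nbhd G v) + (m - 1) * card (dist_nbhd G x v) = D) \<and>
    (\<forall>u v. (u, v) \<in> parcs G \<longrightarrow>
       card (nbhd G u \<inter> nbhd G v) + (m - 1) * card (dist_nbhd G x u \<inter> dist_nbhd G x v) = L) \<and>
    (\<forall>v\<in>pverts G. \<forall>w\<in>dist_nbhd G x v.
       card (dist_nbhd G x v \<inter> nbhd G w) + card (nbhd G v \<inter> dist_nbhd G x w)
         + (m - 2) * card (dist_nbhd G x v \<inter> dist_nbhd G x w) = L)"
    (is "_ \<longleftrightarrow> _ \<and> ?deg \<and> ?same \<and> ?other")
proof -
  let ?H = "shadow m x G"
  \<comment> \<open>The counts do not depend on the copies, so copy 1 represents all arcs inside a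
    copy, and copies 1 and 2 all arcs between copies.\<close>
  have one: "1 \<in> {1..m}" and two: "2 \<in> {1..m}" using assms by auto
  have deg: "(\<forall>p\<in>pverts ?H. card (nbhd ?H p) = D) \<longleftrightarrow> ?deg"
    using one by (auto simp: card_nbhd_shadow)
  have arcs: "(\<forall>p q. (p, q) \<in> parcs ?H \<longrightarrow> card (nbhd ?H p \<inter> nbhd ?H q) = L) \<longleftrightarrow> ?same \<and> ?other"
    (is "?arcs \<longleftrightarrow> _")
  proof (intro iffI conjI allI ballI impI)
    assume H: ?arcs
    fix u v assume uv: "(u, v) \<in> parcs G"
    then have "((u, 1), (v, 1)) \<in> parcs ?H"
      using one by (simp add: parcs_shadow_iff in_nbhd_iff in_arcsD1)
    with H show "card (nbhd G u \<inter> nbhd G v)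
        + (m - 1) * card (dist_nbhd G x u \<inter> dist_nbhd G x v) = L"
      using card_common_nbhd_shadow_same_copy[OF in_arcsD1[OF uv] in_arcsD2[OF uv] one] by metis
  next
    assume H: ?arcs
    fix v w assume v: "v \<in> pverts G" and w: "w \<in> dist_nbhd G x v"
    then have "((v, 1), (w, 2)) \<in> parcs ?H"
      using one two by (simp add: parcs_shadow_iff)
    moreover have "w \<in> pverts G" using w dist_nbhd_subset by blast
    ultimately show "card (dist_nbhd G x v \<inter> nbhd G w) + card (nbhd G v \<inter> dist_nbhd G x w)
        + (m - 2) * card (dist_nbhd G x v \<inter> dist_nbhd G x w) = L"
      using H card_common_nbhd_shadow_other_copy[OF v _ one two]
      by (metis one_eq_numeral_iff semiring_norm(85))
  next
    fix p q assume H: "?same \<and> ?other" and pq: "(p, q) \<in> parcs ?H"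
    obtain u i v j where [simp]: "p = (u, i)" "q = (v, j)" by (cases p, cases q)
    have uv: "u \<in> pverts G" "v \<in> pverts G" "i \<in> {1..m}" "j \<in> {1..m}"
      using pq
      by (auto simp: parcs_shadow_iff split: if_splits
          dest: nbhd_subset[THEN subsetD] dist_nbhd_subset[THEN subsetD])
    show "card (nbhd ?H p \<inter> nbhd ?H q) = L"
    proof (cases "i = j")
      case True
      with pq have "(u, v) \<in> parcs G" by (simp add: parcs_shadow_iff in_nbhd_iff)
      with H True show ?thesis
        using card_common_nbhd_shadow_same_copy[OF uv(1,2,3)] by simp
    next
      case False
      with pq have "v \<in> dist_nbhd G x u" by (simp add: parcs_shadow_iff)
      with H False uv show ?thesis
        using card_common_nbhd_shadow_other_copy[OF uv] by simp
    qed
  qed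
  show ?thesis
    unfolding ER_def using pair_graph_shadow deg arcs by (simp add: card_cartesian_product)
qed

end

theorem theorem2p2:
  fixes G :: "'a pair_pre_digraph" and n d l x m :: nat
  assumes "G \<in> ER n d l" and "x > 0" and "m > 1"
  shows "edge_regular (shadow m x G) \<longleftrightarrow>
    (\<exists>d\<^sub>x l\<^sub>x :: nat.
      (\<forall>v\<in>pverts G. card (dist_nbhd G x v) = d\<^sub>x) \<and>
      (\<forall>u\<in>pverts G. \<forall>v\<in>pverts G. (u, v) \<in> parcs G \<longrightarrow>
         card (dist_nbhd G x u \<inter> dist_nbhd G x v) = l\<^sub>x) \<and>
      (\<forall>v\<in>pverts G. \<forall>w\<in>pverts G. w \<in> dist_nbhd G x v \<longrightarrow>
         card (dist_nbhd G x v \<inter> nbhd G w) + card (nbhd G v \<inter> dist_nbhd G x w)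
           + (m - 2) * card (dist_nbhd G x v \<inter> dist_nbhd G x w)
         = l + (m - 1) * l\<^sub>x))"
proof -
  interpret pair_graph G using assms(1) by (simp add: ER_def)
  have deg: "card (nbhd G v) = d" if "v \<in> pverts G" for v
    using assms(1) that by (simp add: ER_def)
  have common: "card (nbhd G u \<inter> nbhd G v) = l" if "(u, v) \<in> parcs G" for u v
    using assms(1) that by (simp add: ER_def)
  show ?thesis (is "_ \<longleftrightarrow> ?conds")
  proof
    assume "edge_regular (shadow m x G)"
    then obtain N D L where "shadow m x G \<in> ER N D L" by (auto simp: edge_regular_def)
    then have D: "\<And>v. v \<in> pverts G \<Longrightarrow> d + (m - 1) * card (dist_nbhd G x v) = D"
      and same: "\<And>u v. (u, v) \<in> parcs G \<Longrightarrow>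
        l + (m - 1) * card (dist_nbhd G x u \<inter> dist_nbhd G x v) = L"
      and other: "\<And>v w. v \<in> pverts G \<Longrightarrow> w \<in> dist_nbhd G x v \<Longrightarrow>
        card (dist_nbhd G x v \<inter> nbhd G w) + card (nbhd G v \<inter> dist_nbhd G x w)
          + (m - 2) * card (dist_nbhd G x v \<inter> dist_nbhd G x w) = L"
      unfolding shadow_in_ER_iff[OF \<open>m > 1\<close>] using deg common by fastforce+
    \<comment> \<open>The degree equation is solved for the unknown count; the division is exact
      since \<open>m - 1 > 0\<close>. Dividing gives a witness even if \<open>G\<close> has no
      vertex, where \<open>D\<close> is arbitrary.\<close>
    have "card (dist_nbhd G x v) = (D - d) div (m - 1)" if "v \<in> pverts G" for v
      using D[OF that] \<open>m > 1\<close> by auto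
    moreover have l\<^sub>x: "card (dist_nbhd G x u \<inter> dist_nbhd G x v) = (L - l) div (m - 1)"
      if "(u, v) \<in> parcs G" for u v
      using same[OF that] \<open>m > 1\<close> by auto
    \<comment> \<open>In an edgeless \<open>G\<close> the value \<open>L\<close> is arbitrary and
      this equation can fail. A vertex \<open>w\<close> at distance \<open>x > 0\<close> rules that
      case out, and any arc of \<open>G\<close> then determines \<open>L\<close>.\<close>
    moreover have "L = l + (m - 1) * ((L - l) div (m - 1))" if w: "w \<in> dist_nbhd G x v" for v w
    proof -
      have "parcs G \<noteq> {}" using w dist_nbhd_empty_if_no_arcs[OF _ \<open>x > 0\<close>] by blast
      then obtain a b where "(a, b) \<in> parcs G" by auto
      with same l\<^sub>x show ?thesis by metis
    qed
    ultimately show ?conds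
      using other by (intro exI[of _ "(D - d) div (m - 1)"] exI[of _ "(L - l) div (m - 1)"]) metis
  next
    assume ?conds
    then obtain d\<^sub>x l\<^sub>x where "\<forall>v\<in>pverts G. card (dist_nbhd G x v) = d\<^sub>x"
      "\<forall>u\<in>pverts G. \<forall>v\<in>pverts G. (u, v) \<in> parcs G \<longrightarrow>
         card (dist_nbhd G x u \<inter> dist_nbhd G x v) = l\<^sub>x"
      "\<forall>v\<in>pverts G. \<forall>w\<in>pverts G. w \<in> dist_nbhd G x v \<longrightarrow>
         card (dist_nbhd G x v \<inter> nbhd G w) + card (nbhd G v \<inter> dist_nbhd G x w)
           + (m - 2) * card (dist_nbhd G x v \<inter> dist_nbhd G x w) = l + (m - 1) * l\<^sub>x"
      by blast
    \<comment> \<open>By (2), arcs inside a copy have \<open>l + (m - 1) * l\<^sub>x\<close> common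
      neighbors; (3) gives arcs between copies the same number.\<close>
    then have "shadow m x G \<in> ER (card (pverts G) * m) (d + (m - 1) * d\<^sub>x) (l + (m - 1) * l\<^sub>x)"
      unfolding shadow_in_ER_iff[OF \<open>m > 1\<close>]
      using deg common dist_nbhd_subset by (auto simp: in_arcsD1 in_arcsD2 subset_iff)
    then show "edge_regular (shadow m x G)" by (auto simp: edge_regular_def)
  qed
qed

end
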